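(* Let $E$ be a second-countable real Hilbert space equipped with its Borel $\sigma$-algebra, and let $\mu$ be a finite measure on $E$. Then $\mu$ is Gaussian if and only if $\mu$ has finite second moment and its characteristic function is given by $$\psi_\mu(t)=\exp\big(i\langle t,\mathbf E_\mu[\mathrm{id}]\rangle-C_\mu(t,t)/2\big)\qquad\text{for all }t\in E.$$
   Context: $\mu$ is Gaussian if for each continuous linear form $L:E\to\mathbb R$ the pushforward $L_*\mu$ is the real normal distribution $N(\mathbf E_\mu[L],\mathrm{var}_\mu(L))$ (with $N(m,0)=\delta_m$), where $\mathbf E_\mu$, $\mathrm{var}_\mu$ are expectation and variance under $\mu$. The characteristic function is $\psi_\mu:E\to\mathbb C$, $\psi_\mu(t)=\int_E e^{i\langle t,x\rangle}\mu(\mathrm dx)$. $\mathbf E_\mu[\mathrm{id}]=\int_E x\,\mu(\mathrm dx)$ (Bochner integral). Finite second moment means $\int_E\|x\|^2\mu(\mathrm dx)<\infty$; in that case the covariance bilinear form is $C_\mu(s,t)=\mathbf{cov}_\mu(\langle s,\cdot\rangle,\langle t,\cdot\rangle)$ for $s,t\in E$. *)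

theory Defs
  imports "HOL-Probability.Probability"
begin

text \<open>The real normal law with mean \<open>m\<close> and variance \<open>v \<ge> 0\<close>, including the Dirac case \<open>v = 0\<close>.
  The second parameter of \<open>normal_density\<close> is the standard deviation.\<close>

definition normal_law :: "real \<Rightarrow> real \<Rightarrow> real measure" where
  "normal_law m v =
     (if v = 0 then return borel m else density lborel (normal_density m (sqrt v)))"

definition covariance :: "'a measure \<Rightarrow> ('a \<Rightarrow> real) \<Rightarrow> ('a \<Rightarrow> real) \<Rightarrow> real" where
  "covariance M f g =
     (\<integral>x. (f x - (\<integral>y. f y \<partial>M)) * (g x - (\<integral>y. g y \<partial>M)) \<partial>M)"

definition var :: "'a measure \<Rightarrow> ('a \<Rightarrow> real) \<Rightarrow> real" where
  "var M f = (\<integral>x. (f x - (\<integral>y. f y \<partial>M))\<^sup>2 \<partial>M)"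

text \<open>No separate integrability condition on \<open>L\<close> is needed: the equation of measures forces
  \<open>L\<close> to be square-integrable (lemma \<open>gaussian_imp_square_integrable\<close>), so the
  default value of non-existing integrals plays no role.\<close>

definition gaussian :: "'a::real_normed_vector measure \<Rightarrow> bool" where
  "gaussian M \<longleftrightarrow>
     (\<forall>L::'a \<Rightarrow> real. bounded_linear L \<longrightarrow>
        distr M borel L = normal_law (\<integral>x. L x \<partial>M) (var M L))"

definition char_fun :: "'a::real_inner measure \<Rightarrow> 'a \<Rightarrow> complex" where
  "char_fun M t = (\<integral>x. exp (\<i> * complex_of_real (t \<bullet> x)) \<partial>M)"

definition finite_second_moment :: "'a::real_normed_vector measure \<Rightarrow> bool" where
  "finite_second_moment M \<longleftrightarrow> (\<integral>\<^sup>+x. ennreal ((norm x)\<^sup>2) \<partial>M) < \<infinity>"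

definition cov_form :: "'a::real_inner measure \<Rightarrow> 'a \<Rightarrow> 'a \<Rightarrow> real" where
  "cov_form M s t = covariance M (\<lambda>x. s \<bullet> x) (\<lambda>x. t \<bullet> x)"

lemma gaussian_imp_square_integrable:
  fixes M :: "'a::real_normed_vector measure" and L :: "'a \<Rightarrow> real"
  assumes "sets M = sets borel" and "gaussian M" and "bounded_linear L"
  shows "integrable M L" and "integrable M (\<lambda>x. (L x)\<^sup>2)"
proof -
  have L: "L \<in> measurable M borel"
    using borel_measurable_continuous_onI[OF linear_continuous_on[OF assms(3)]] assms(1)
    by (simp cong: measurable_cong_sets)
  define m v where "m = (\<integral>x. L x \<partial>M)" and "v = var M L"
  have d: "distr M borel L = normal_law m v"
    using assms(2,3) by (simp add: gaussian_def m_def v_def)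
  have v: "v \<ge> 0" by (simp add: v_def var_def)
  have "integrable (normal_law m v) (\<lambda>x. x ^ k)" if "k \<in> {1, 2}" for k
  proof (cases "v = 0")
    case True
    have "integrable (return borel m) (\<lambda>x::real. x ^ k)"
      by (rule integrableI_bounded) (simp_all add: nn_integral_return)
    with True show ?thesis by (simp add: normal_law_def)
  next
    case False
    with v have s: "sqrt v > 0" by simp
    have 1: "integrable lborel (\<lambda>x. normal_density m (sqrt v) x * (x - m))"
      using integrable_normal_moment[OF s, of m 1] by simp
    have 2: "integrable lborel (\<lambda>x. normal_density m (sqrt v) x * (x - m)\<^sup>2)"
      using integrable_normal_moment[OF s, of m 2] by simp
    have 0: "integrable lborel (\<lambda>x. normal_density m (sqrt v) x)"
      using integrable_normal_moment[OF s, of m 0] by simp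
    have "integrable lborel (\<lambda>x. normal_density m (sqrt v) x * x)"
      using Bochner_Integration.integrable_add[OF 1 integrable_mult_right[OF 0, of m]]
      by (simp add: algebra_simps)
    moreover have "integrable lborel (\<lambda>x. normal_density m (sqrt v) x * x\<^sup>2)"
      using Bochner_Integration.integrable_add[OF 2 Bochner_Integration.integrable_add[OF integrable_mult_right[OF 1, of "2*m"]
          integrable_mult_right[OF 0, of "m\<^sup>2"]]]
      by (simp add: algebra_simps power2_eq_square)
    ultimately show ?thesis
      using False that by (auto simp: normal_law_def integrable_density)
  qed
  then have *: "integrable (distr M borel L) (\<lambda>x. x ^ k)" if "k \<in> {1, 2}" for k
    using d that by simp
  show "integrable M L" using *[of 1] L by (simp add: integrable_distr_eq)
  show "integrable M (\<lambda>x. (L x)\<^sup>2)" using *[of 2] L by (simp add: integrable_distr_eq)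
qed

end

theory Submission imports Defs begin

text \<open>If every \<open>\<langle>t, \<cdot>\<rangle>\<close> is normal, then \<open>E\<langle>t,x\<rangle>\<^sup>4 \<le> 3 (E\<langle>t,x\<rangle>\<^sup>2)\<^sup>2\<close>. Choosing \<open>R\<close> with
  \<open>P(\<parallel>x\<parallel> > R) \<le> 1/12\<close>, Cauchy--Schwarz shows that at least half of every second moment
  \<open>E\<langle>t,x\<rangle>\<^sup>2\<close> comes from the ball of radius \<open>R\<close>, uniformly in \<open>t\<close>. Summing over an orthonormal
  basis of a finite-dimensional subspace gives \<open>E\<parallel>P x\<parallel>\<^sup>2 \<le> 2 R\<^sup>2\<close> for its projection \<open>P\<close>, and Fatou's
  lemma along an exhausting sequence of subspaces gives \<open>E\<parallel>x\<parallel>\<^sup>2 < \<infinity>\<close>. The formula for the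
  characteristic function is then one-dimensional. Conversely, every bounded linear form is some
  \<open>\<langle>t, \<cdot>\<rangle>\<close> by Riesz, and its law is identified by Levy's uniqueness theorem.\<close>

section \<open>Riesz representation of continuous linear forms\<close>

text \<open>The representing vector maximizes \<open>2 L x - \<parallel>x\<parallel>\<^sup>2\<close>; the parallelogram law makes every
  maximizing sequence Cauchy.\<close>

lemma riesz_representation:
  fixes L :: "'a::{real_inner, complete_space} \<Rightarrow> real"
  assumes "bounded_linear L"
  obtains t where "L = (\<lambda>x. t \<bullet> x)"
proof -
  interpret L: bounded_linear L by fact
  define Q where "Q x = 2 * L x - (norm x)\<^sup>2" for x
  obtain K where K: "\<And>x. norm (L x) \<le> norm x * K"
    using L.bounded by blast
  have "Q x \<le> K\<^sup>2" for x
  proof -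
    have "0 \<le> (norm x - K)\<^sup>2" by simp
    moreover have "L x \<le> norm x * K" using K[of x] by simp
    ultimately show ?thesis by (simp add: Q_def power2_diff)
  qed
  then have bdd: "bdd_above (range Q)" by (auto intro!: bdd_aboveI[where M = "K\<^sup>2"])
  define s where "s = (SUP x. Q x)"
  have Q_le: "Q x \<le> s" for x
    unfolding s_def by (rule cSUP_upper[OF _ bdd]) simp
  have "\<exists>x. s - 1 / Suc n < Q x" for n
    using less_cSUP_iff[OF _ bdd, of "s - 1 / Suc n"] by (simp add: s_def)
  then obtain X where X: "\<And>n. s - 1 / Suc n < Q (X n)" by metis
  have gap: "(dist x y)\<^sup>2 \<le> 2 * (s - Q x) + 2 * (s - Q y)" for x y
  proof -
    have "4 * Q ((1/2) *\<^sub>R (x + y)) = 2 * Q x + 2 * Q y + (dist x y)\<^sup>2"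
      by (simp add: Q_def L.scaleR L.add dist_norm power2_norm_eq_inner power_mult_distrib
          inner_simps inner_commute algebra_simps)
    with Q_le[of "(1/2) *\<^sub>R (x + y)"] show ?thesis by simp
  qed
  have "Cauchy X"
  proof (rule metric_CauchyI)
    fix e :: real assume e: "e > 0"
    \<comment> \<open>By \<open>gap\<close>, two points whose deficits from \<open>s\<close> are
      below \<open>c\<close> have squared distance below \<open>4 * c\<close>, which is
      \<open>e\<^sup>2\<close>.\<close>
    define c where "c = e\<^sup>2 / 4"
    have "c > 0" using e by (simp add: c_def)
    then obtain N where N: "1 / real (Suc N) < c"
      using nat_approx_posE by blast
    have small: "s - Q (X n) < c" if "n \<ge> N" for n
    proof -
      have "1 / real (Suc n) \<le> 1 / real (Suc N)" using that by (simp add: frac_le)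
      with X[of n] N show ?thesis by linarith
    qed
    have "dist (X m) (X n) < e" if "m \<ge> N" "n \<ge> N" for m n
    proof -
      note gap[of "X m" "X n"]
      also have "2 * (s - Q (X m)) + 2 * (s - Q (X n)) < 2 * c + 2 * c"
        by (intro add_strict_mono mult_strict_left_mono small that) simp_all
      also have "2 * c + 2 * c = e\<^sup>2" by (simp add: c_def)
      finally show ?thesis using e by (simp add: power2_less_imp_less)
    qed
    then show "\<exists>N. \<forall>m\<ge>N. \<forall>n\<ge>N. dist (X m) (X n) < e" by blast
  qed
  then obtain t where t: "X \<longlonglongrightarrow> t"
    using Cauchy_convergent_iff convergent_def by blast
  have "(\<lambda>n. Q (X n)) \<longlonglongrightarrow> Q t"
    unfolding Q_def by (intro tendsto_intros L.tendsto t)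
  moreover have "(\<lambda>n. s - 1 / Suc n) \<longlonglongrightarrow> s - 0"
    by (intro tendsto_diff tendsto_const lim_1_over_n[THEN LIMSEQ_Suc])
  ultimately have Qt: "s \<le> Q t"
    using LIMSEQ_le[of "\<lambda>n. s - 1 / Suc n" s "\<lambda>n. Q (X n)" "Q t"] X
    by (auto intro: less_imp_le)
  have "L x = t \<bullet> x" for x
  proof (cases "x = 0")
    case False
    define d where "d = L x - t \<bullet> x"
    \<comment> \<open>Moving from \<open>t\<close> by \<open>r *\<^sub>R x\<close> changes
      \<open>Q\<close> by \<open>2 * r * d - r\<^sup>2 * (x \<bullet> x)\<close>. This
      \<open>r\<close> maximizes the gain, with value \<open>d\<^sup>2 / (x \<bullet> x)\<close>; as
      \<open>t\<close> is a maximizer, \<open>d\<close> must vanish.\<close>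
    define r where "r = d / (x \<bullet> x)"
    have "(norm (t + r *\<^sub>R x))\<^sup>2 = (norm t)\<^sup>2 + 2 * r * (t \<bullet> x) + r\<^sup>2 * (x \<bullet> x)"
      unfolding power2_norm_eq_inner
      by (simp add: inner_simps inner_commute algebra_simps power2_eq_square)
    then have "Q (t + r *\<^sub>R x) = Q t + 2 * r * d - r\<^sup>2 * (x \<bullet> x)"
      by (simp add: Q_def d_def L.scaleR L.add algebra_simps)
    also have "\<dots> = Q t + d\<^sup>2 / (x \<bullet> x)"
      using False by (simp add: r_def field_simps power2_eq_square)
    finally have "d\<^sup>2 / (x \<bullet> x) \<le> 0" using Q_le[of "t + r *\<^sub>R x"] Qt by simp
    moreover have "x \<bullet> x > 0" using False by simp
    ultimately have "d = 0" by (simp add: divide_le_0_iff)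
    then show ?thesis by (simp add: d_def)
  qed (simp add: L.zero)
  with that show ?thesis by blast
qed

section \<open>Real normal laws: characteristic functions and moments\<close>

text \<open>The affine image also covers the Dirac case, so characteristic function and moments
  reduce to the standard normal law without a case split.\<close>

lemma normal_law_eq_distr:
  assumes "v \<ge> 0"
  shows "normal_law m v = distr std_normal_distribution borel (\<lambda>x. m + sqrt v * x)"
proof (cases "v = 0")
  case True
  interpret real_distribution std_normal_distribution by (rule real_dist_normal_dist)
  have "distr std_normal_distribution borel (\<lambda>x. m) = return borel m"
    by (simp add: distr_const)
  with True show ?thesis by (simp add: normal_law_def)
next
  case False
  interpret real_distribution std_normal_distribution by (rule real_dist_normal_dist)
  have "distributed std_normal_distribution lborel (\<lambda>x. x) std_normal_density"
    unfolding distributed_def by (auto simp: distr_id2 cong: distr_cong)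
  from normal_density_affine[OF this, of "sqrt v" m] False assms
  have "distributed std_normal_distribution lborel (\<lambda>x. m + sqrt v * x) (normal_density m (sqrt v))"
    by simp
  then have "distr std_normal_distribution lborel (\<lambda>x. m + sqrt v * x) = density lborel (normal_density m (sqrt v))"
    by (rule distributed_distr_eq_density)
  moreover have "distr std_normal_distribution lborel (\<lambda>x. m + sqrt v * x)
      = distr std_normal_distribution borel (\<lambda>x. m + sqrt v * x)"
    by (rule distr_cong) simp_all
  ultimately show ?thesis using False by (simp add: normal_law_def)
qed

lemma real_distribution_normal_law:
  assumes "v \<ge> 0"
  shows "real_distribution (normal_law m v)"
proof -
  interpret real_distribution std_normal_distribution by (rule real_dist_normal_dist)
  show ?thesis unfolding normal_law_eq_distr[OF assms] by (intro real_distribution_distr) simp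
qed

lemma char_normal_law:
  assumes "v \<ge> 0"
  shows "char (normal_law m v) u = exp (\<i> * (u * m) - u\<^sup>2 * v / 2)"
proof -
  have "char (normal_law m v) u = (CLINT x|std_normal_distribution. iexp (u * (m + sqrt v * x)))"
    unfolding normal_law_eq_distr[OF assms] char_def by (simp add: integral_distr)
  also have "\<dots> = (CLINT x|std_normal_distribution. iexp (u * m) * iexp ((u * sqrt v) * x))"
    by (simp add: exp_add[symmetric] algebra_simps)
  also have "\<dots> = iexp (u * m) * char std_normal_distribution (u * sqrt v)"
    by (simp add: char_def)
  also have "\<dots> = exp (\<i> * (u * m) - u\<^sup>2 * v / 2)"
    using assms
    by (simp add: char_std_normal_distribution exp_of_real[symmetric] exp_add[symmetric]
        power_mult_distrib)
      (metis of_real_power real_sqrt_pow2)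
  finally show ?thesis .
qed

text \<open>Expand \<open>(m + s * x) ^ k\<close> for \<open>k = 2, 4\<close> and insert the
  standard normal moments 1, 0, 1, 0, 3 of orders 0 to 4. Orders two and four are what the
  fourth-moment comparison needs.\<close>

lemma normal_law_moments:
  assumes "v \<ge> 0"
  shows "integrable (normal_law m v) (\<lambda>x. x ^ 2)"
    and "integrable (normal_law m v) (\<lambda>x. x ^ 4)"
    and "(\<integral>x. x ^ 2 \<partial>normal_law m v) = m\<^sup>2 + v"
    and "(\<integral>x. x ^ 4 \<partial>normal_law m v) = m ^ 4 + 6 * m\<^sup>2 * v + 3 * v\<^sup>2"
proof -
  let ?N = "std_normal_distribution"
  define s where "s = sqrt v"
  have s2: "s\<^sup>2 = v" using assms by (simp add: s_def)
  then have s4: "s ^ 4 = v\<^sup>2" using power_mult[of s 2 2] by simp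
  have I: "has_bochner_integral ?N (\<lambda>x. x ^ 0) 1" "has_bochner_integral ?N (\<lambda>x. x ^ 1) 0"
     "has_bochner_integral ?N (\<lambda>x. x ^ 2) 1" "has_bochner_integral ?N (\<lambda>x. x ^ 3) 0"
     "has_bochner_integral ?N (\<lambda>x. x ^ 4) 3"
    using std_normal_distribution_even_moments(1)[of 0] std_normal_distribution_even_moments(1)[of 1]
      std_normal_distribution_even_moments(1)[of 2] integral_std_normal_distribution_moment_odd[of 1]
      integral_std_normal_distribution_moment_odd[of 3]
      integrable_std_normal_distribution_moment[of 0] integrable_std_normal_distribution_moment[of 1]
      integrable_std_normal_distribution_moment[of 2] integrable_std_normal_distribution_moment[of 3]
      integrable_std_normal_distribution_moment[of 4]
    by (simp_all add: has_bochner_integral_iff fact_numeral)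
  have "has_bochner_integral ?N (\<lambda>x. m\<^sup>2 * x ^ 0 + (2 * m * s) * x ^ 1 + s\<^sup>2 * x ^ 2)
      (m\<^sup>2 * 1 + (2 * m * s) * 0 + s\<^sup>2 * 1)"
    by (intro has_bochner_integral_add has_bochner_integral_mult_right I)
  then have 2: "has_bochner_integral ?N (\<lambda>x. (m + s * x)\<^sup>2) (m\<^sup>2 + v)"
    by (simp add: power2_eq_square algebra_simps s2[unfolded power2_eq_square])
  have "has_bochner_integral ?N (\<lambda>x. m ^ 4 * x ^ 0 + (4 * m ^ 3 * s) * x ^ 1 + (6 * m\<^sup>2 * s\<^sup>2) * x ^ 2
        + (4 * m * s ^ 3) * x ^ 3 + s ^ 4 * x ^ 4)
      (m ^ 4 * 1 + (4 * m ^ 3 * s) * 0 + (6 * m\<^sup>2 * s\<^sup>2) * 1 + (4 * m * s ^ 3) * 0 + s ^ 4 * 3)"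
    by (intro has_bochner_integral_add has_bochner_integral_mult_right I)
  moreover have "m ^ 4 * x ^ 0 + (4 * m ^ 3 * s) * x ^ 1 + (6 * m\<^sup>2 * s\<^sup>2) * x ^ 2
        + (4 * m * s ^ 3) * x ^ 3 + s ^ 4 * x ^ 4 = (m + s * x) ^ 4" for x
    by algebra
  ultimately have 4: "has_bochner_integral ?N (\<lambda>x. (m + s * x) ^ 4) (m ^ 4 + 6 * m\<^sup>2 * v + 3 * v\<^sup>2)"
    by (simp add: s2 s4 mult.commute)
  show "integrable (normal_law m v) (\<lambda>x. x ^ 2)"
    "integrable (normal_law m v) (\<lambda>x. x ^ 4)"
    "(\<integral>x. x ^ 2 \<partial>normal_law m v) = m\<^sup>2 + v"
    "(\<integral>x. x ^ 4 \<partial>normal_law m v) = m ^ 4 + 6 * m\<^sup>2 * v + 3 * v\<^sup>2"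
    using 2 4 unfolding normal_law_eq_distr[OF assms]
    by (simp_all add: has_bochner_integral_iff integrable_distr_eq integral_distr s_def)
qed

section \<open>Bochner integrability from a finite norm integral\<close>

text \<open>The library counterpart \<open>integrableI_bounded\<close> needs the class \<open>banach\<close>, which a type variable of
  sort \<open>{real_normed_vector, complete_space}\<close> does not have.\<close>

lemma integrable_if_norm_finite:
  fixes f :: "'a \<Rightarrow> 'b::{real_normed_vector, complete_space, second_countable_topology}"
  assumes "finite_measure M" and [measurable]: "f \<in> borel_measurable M"
    and fin: "(\<integral>\<^sup>+x. norm (f x) \<partial>M) < \<infinity>"
  shows "integrable M f"
proof -
  interpret finite_measure M by fact
  from borel_measurable_implies_sequence_metric[OF assms(2), of 0] obtain s where
    s: "\<And>i. simple_function M (s i)" and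
    lim: "\<And>x. x \<in> space M \<Longrightarrow> (\<lambda>i. s i x) \<longlonglongrightarrow> f x" and
    bound: "\<And>i x. x \<in> space M \<Longrightarrow> norm (s i x) \<le> 2 * norm (f x)"
    by simp metis
  have [measurable]: "s i \<in> borel_measurable M" for i
    using s by (rule borel_measurable_simple_function)
  \<comment> \<open>Finiteness of \<open>M\<close> enters here: a simple function then has support
    of finite measure.\<close>
  have sb: "Bochner_Integration.simple_bochner_integrable M (s i)" for i
    by (simp add: simple_bochner_integrable.simps s emeasure_eq_measure)
  let ?S = "\<lambda>i. \<integral>\<^sup>+x. norm (f x - s i x) \<partial>M" and ?I = "\<lambda>i. Bochner_Integration.simple_bochner_integral M (s i)"
  have S: "?S \<longlonglongrightarrow> 0"
  proof (rule nn_integral_dominated_convergence_norm[where w = "\<lambda>x. 2 * norm (f x)"])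
    show "(\<integral>\<^sup>+x. ennreal (2 * norm (f x)) \<partial>M) < \<infinity>"
      using fin by (simp add: ennreal_mult nn_integral_cmult ennreal_mult_less_top)
  qed (use bound lim in auto)
  \<comment> \<open>Integrals of simple functions differ by at most their L1 distance, so they are
    Cauchy; completeness of the codomain supplies the value of the integral.\<close>
  have "Cauchy ?I"
  proof (rule metric_CauchyI)
    fix e :: real assume "e > 0"
    then obtain N where N: "\<And>n. n \<ge> N \<Longrightarrow> ?S n < ennreal (e / 2)"
      using order_tendstoD(2)[OF S, of "ennreal (e / 2)"] by (auto simp: eventually_sequentially)
    have "dist (?I m) (?I n) < e" if "m \<ge> N" "n \<ge> N" for m n
    proof -
      have "ennreal (dist (?I m) (?I n)) \<le> ?S m + ?S n"
        unfolding dist_norm by (intro simple_bochner_integral_bounded sb) simp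
      also have "\<dots> < ennreal (e / 2) + ennreal (e / 2)"
        by (intro add_strict_mono N that)
      also have "\<dots> = ennreal e"
        using \<open>e > 0\<close> by (simp flip: ennreal_plus)
      finally show ?thesis by (simp add: ennreal_less_iff)
    qed
    then show "\<exists>N. \<forall>m\<ge>N. \<forall>n\<ge>N. dist (?I m) (?I n) < e" by blast
  qed
  then obtain y where "?I \<longlonglongrightarrow> y"
    using Cauchy_convergent_iff convergent_def by blast
  with S sb have "has_bochner_integral M f y"
    by (intro has_bochner_integral.intros) auto
  then show ?thesis by (rule integrable.intros)
qed


section \<open>Orthogonal expansions in a separable inner product space\<close>

text \<open>\<open>C\<close> may contain \<open>0\<close>, whose summand is \<open>0/0 = 0\<close>.\<close>

lemma orthogonal_expansion:
  fixes C :: "'a::real_inner set"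
  assumes "finite C" "pairwise orthogonal C"
  shows bessel_inequality: "(\<Sum>b\<in>C. (b \<bullet> x)\<^sup>2 / (b \<bullet> b)) \<le> (norm x)\<^sup>2"
    and norm_le_expansion: "d \<in> span C \<Longrightarrow>
      (norm x)\<^sup>2 \<le> (\<Sum>b\<in>C. (b \<bullet> x)\<^sup>2 / (b \<bullet> b)) + (norm (x - d))\<^sup>2"
proof -
  \<comment> \<open>The orthogonal projection of \<open>x\<close> onto \<open>span C\<close>. Both
    inequalities come from Pythagoras for \<open>x = P + (x - P)\<close>.\<close>
  define P where "P = (\<Sum>b\<in>C. (b \<bullet> x / (b \<bullet> b)) *\<^sub>R b)"
  have P_span: "P \<in> span C"
    unfolding P_def by (intro span_sum span_scale span_base)
  have "orthogonal (x - P) c" if "c \<in> C" for c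
  proof -
    have "P \<bullet> c = (\<Sum>b\<in>C. if b = c then c \<bullet> x else 0)"
      unfolding P_def inner_sum_left
      using assms(2) that by (intro sum.cong) (auto simp: pairwise_def orthogonal_def)
    also have "\<dots> = c \<bullet> x" using assms(1) that by simp
    finally show ?thesis by (simp add: orthogonal_def inner_diff_left inner_commute[of x c])
  qed
  then have orth: "(x - P) \<bullet> y = 0" if "y \<in> span C" for y
    using orthogonal_to_span[OF that] by (simp add: orthogonal_def)
  have Px: "P \<bullet> x = (\<Sum>b\<in>C. (b \<bullet> x)\<^sup>2 / (b \<bullet> b))"
    by (simp add: P_def inner_sum_left power2_eq_square)
  have norm_eq: "(norm x)\<^sup>2 = P \<bullet> x + (norm (x - P))\<^sup>2"
    using orth[OF P_span]
    by (simp add: power2_norm_eq_inner inner_simps inner_commute)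
  then show "(\<Sum>b\<in>C. (b \<bullet> x)\<^sup>2 / (b \<bullet> b)) \<le> (norm x)\<^sup>2"
    by (simp add: Px)
  assume "d \<in> span C"
  \<comment> \<open>Pythagoras again: \<open>P\<close> is the point of \<open>span C\<close> nearest
    to \<open>x\<close>, so \<open>d\<close> can only be farther away.\<close>
  then have "(x - P) \<bullet> (P - d) = 0" by (intro orth span_diff P_span)
  then have "(norm (x - d))\<^sup>2 = (norm (x - P))\<^sup>2 + (norm (P - d))\<^sup>2"
    by (simp add: power2_norm_eq_inner inner_simps inner_commute)
  then have "(norm (x - P))\<^sup>2 \<le> (norm (x - d))\<^sup>2" by simp
  with norm_eq show "(norm x)\<^sup>2 \<le> (\<Sum>b\<in>C. (b \<bullet> x)\<^sup>2 / (b \<bullet> b)) + (norm (x - d))\<^sup>2"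
    by (simp add: Px)
qed

text \<open>Gram-Schmidt is applied to initial segments of a dense sequence. Bessel bounds the sums
  from above; a sequence point close to \<open>x\<close> bounds them from below as soon as it lies
  in the span.\<close>

lemma orthogonal_approximation:
  obtains C :: "nat \<Rightarrow> 'a::{real_inner, second_countable_topology} set"
  where "\<And>n. finite (C n)" "\<And>n. pairwise orthogonal (C n)"
    "\<And>x. (\<lambda>n. \<Sum>b\<in>C n. (b \<bullet> x)\<^sup>2 / (b \<bullet> b)) \<longlonglongrightarrow> (norm x)\<^sup>2"
proof -
  obtain D :: "'a set" where "countable D" and D: "\<And>X. open X \<Longrightarrow> X \<noteq> {} \<Longrightarrow> \<exists>d\<in>D. d \<in> X"
    by (erule countable_dense_setE)
  define e where "e = from_nat_into D"
  have "D \<noteq> {}" using D[of UNIV] by auto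
  with \<open>countable D\<close> have range_e: "range e = D"
    by (simp add: e_def range_from_nat_into)
  have "\<exists>C. finite C \<and> pairwise orthogonal C \<and> span C = span (e ` {..n})" for n
    using basis_orthogonal[of "e ` {..n}"] by auto
  then obtain C where C: "\<And>n. finite (C n)" "\<And>n. pairwise orthogonal (C n)"
      "\<And>n. span (C n) = span (e ` {..n})"
    by metis
  let ?q = "\<lambda>x n. \<Sum>b\<in>C n. (b \<bullet> x)\<^sup>2 / (b \<bullet> b)"
  have "?q x \<longlonglongrightarrow> (norm x)\<^sup>2" for x
  proof (rule LIMSEQ_I)
    fix r :: real assume "r > 0"
    then have "\<exists>d\<in>D. d \<in> ball x (sqrt r)" by (intro D) auto
    then obtain k where "e k \<in> ball x (sqrt r)" using range_e by blast
    then have "norm (x - e k) < sqrt r" by (simp add: dist_norm)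
    then have k: "(norm (x - e k))\<^sup>2 < r"
      using \<open>r > 0\<close> real_less_rsqrt by (metis norm_ge_zero real_sqrt_less_iff real_sqrt_unique)
    have "norm (?q x n - (norm x)\<^sup>2) < r" if "n \<ge> k" for n
    proof -
      \<comment> \<open>The spans increase with \<open>n\<close>, so one good approximant
        \<open>e k\<close> serves all later indices.\<close>
      have "e k \<in> span (C n)" using that by (auto simp: C(3) intro: span_base)
      from norm_le_expansion[OF C(1,2) this, of x] bessel_inequality[OF C(1)[of n] C(2)[of n], of x] k
      show ?thesis by simp
    qed
    then show "\<exists>k. \<forall>n\<ge>k. norm (?q x n - (norm x)\<^sup>2) < r" by blast
  qed
  with C that show ?thesis by blast
qed

section \<open>Finite second moment of Gaussian measures\<close>

text \<open>The zero form suffices: its law must be the Dirac measure at 0, and a pushforward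
  preserves total mass.\<close>

lemma gaussian_imp_prob_space:
  fixes M :: "'a::real_normed_vector measure"
  assumes "sets M = sets borel" "gaussian M"
  shows "prob_space M"
proof -
  have "distr M borel (\<lambda>x. 0::real) = normal_law 0 0"
    using assms(2)[unfolded gaussian_def, rule_format, of "\<lambda>x. 0"] by (simp add: var_def bounded_linear_zero)
  then have "emeasure (distr M borel (\<lambda>x. 0::real)) UNIV = 1"
    by (simp add: normal_law_def)
  then have "emeasure M (space M) = 1"
    by (simp add: emeasure_distr)
  then show ?thesis by (rule prob_spaceI)
qed

lemma var_nonneg: "var M f \<ge> 0"
  by (simp add: var_def)

lemma gaussian_inner_moments:
  fixes M :: "'a::{real_inner, second_countable_topology} measure"
  assumes "sets M = sets borel" "gaussian M"
  shows "integrable M (\<lambda>x. (t \<bullet> x)\<^sup>2)" and "integrable M (\<lambda>x. (t \<bullet> x) ^ 4)"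
    and "(\<integral>x. (t \<bullet> x) ^ 4 \<partial>M) \<le> 3 * (\<integral>x. (t \<bullet> x)\<^sup>2 \<partial>M)\<^sup>2"
proof -
  note assms(1)[measurable_cong]
  define m v where "m = (\<integral>x. t \<bullet> x \<partial>M)" and "v = var M (\<lambda>x. t \<bullet> x)"
  have v: "v \<ge> 0" by (simp add: v_def var_nonneg)
  have d: "normal_law m v = distr M borel (\<lambda>x. t \<bullet> x)"
    using assms(2) bounded_linear_inner_right[of t] by (simp add: gaussian_def m_def v_def)
  note mom = normal_law_moments[OF v, of m, unfolded d]
  show "integrable M (\<lambda>x. (t \<bullet> x)\<^sup>2)" "integrable M (\<lambda>x. (t \<bullet> x) ^ 4)"
    using mom(1,2) by (simp_all add: integrable_distr_eq)
  have "(\<integral>x. (t \<bullet> x)\<^sup>2 \<partial>M) = m\<^sup>2 + v"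
    and "(\<integral>x. (t \<bullet> x) ^ 4 \<partial>M) = m ^ 4 + 6 * m\<^sup>2 * v + 3 * v\<^sup>2"
    using mom(3,4) by (simp_all add: integral_distr)
  moreover have "3 * (m\<^sup>2 + v)\<^sup>2 = m ^ 4 + 6 * m\<^sup>2 * v + 3 * v\<^sup>2 + 2 * m ^ 4"
    by algebra
  ultimately show "(\<integral>x. (t \<bullet> x) ^ 4 \<partial>M) \<le> 3 * (\<integral>x. (t \<bullet> x)\<^sup>2 \<partial>M)\<^sup>2"
    by simp
qed

lemma gaussian_second_moment_truncation:
  fixes M :: "'a::{real_inner, second_countable_topology} measure"
  assumes "sets M = sets borel" "gaussian M"
  obtains R where
    "\<And>t. (\<integral>x. (t \<bullet> x)\<^sup>2 \<partial>M) \<le> 2 * (\<integral>x. (t \<bullet> x)\<^sup>2 * indicator (cball 0 R) x \<partial>M)"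
proof -
  note assms(1)[measurable_cong]
  interpret prob_space M by (rule gaussian_imp_prob_space[OF assms])
  have sp: "space M = UNIV" using sets_eq_imp_space_eq[OF assms(1)] by simp
  \<comment> \<open>Continuity from above: the complements of growing balls decrease to the empty
    set.\<close>
  have "(\<lambda>n::nat. measure M (- cball 0 (real n))) \<longlonglongrightarrow> measure M (\<Inter>n::nat. - cball 0 (real n))"
    by (rule finite_Lim_measure_decseq) (auto simp: decseq_def assms(1))
  moreover have "(\<Inter>n::nat. - cball (0::'a) (real n)) = {}"
  proof (rule equals0I)
    fix x :: 'a assume x: "x \<in> (\<Inter>n::nat. - cball 0 (real n))"
    obtain n where "norm x \<le> real n" using real_arch_simple by blast
    then have "x \<in> cball 0 (real n)" by simp
    with x show False by blast
  qed
  ultimately have "(\<lambda>n::nat. measure M (- cball 0 (real n))) \<longlonglongrightarrow> 0" by simp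
  then have "eventually (\<lambda>n::nat. measure M (- cball 0 (real n)) < 1 / 12) sequentially"
    by (rule order_tendstoD) simp
  then obtain n :: nat where n: "measure M (- cball 0 (real n)) < 1 / 12"
    by (auto simp: eventually_sequentially)
  let ?B = "cball (0::'a) (real n)"
  have [measurable]: "?B \<in> sets M" "- ?B \<in> sets M" by (simp_all add: assms(1))
  have "(\<integral>x. (t \<bullet> x)\<^sup>2 \<partial>M) \<le> 2 * (\<integral>x. (t \<bullet> x)\<^sup>2 * indicator ?B x \<partial>M)" for t
  proof -
    note mom = gaussian_inner_moments[OF assms, of t]
    define E where "E = (\<integral>x. (t \<bullet> x)\<^sup>2 \<partial>M)"
    have "E \<ge> 0" by (simp add: E_def)
    have iB: "integrable M (\<lambda>x. (t \<bullet> x)\<^sup>2 * indicator A x)" if "A \<in> sets M" for A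
      using integrable_mult_indicator[OF that mom(1)] by (simp add: mult.commute)
    have "E = (\<integral>x. (t \<bullet> x)\<^sup>2 * indicator ?B x + (t \<bullet> x)\<^sup>2 * indicator (- ?B) x \<partial>M)"
      unfolding E_def by (intro Bochner_Integration.integral_cong) (auto simp: indicator_def)
    also have "\<dots> = (\<integral>x. (t \<bullet> x)\<^sup>2 * indicator ?B x \<partial>M) + (\<integral>x. (t \<bullet> x)\<^sup>2 * indicator (- ?B) x \<partial>M)"
      by (intro Bochner_Integration.integral_add iB) simp_all
    also have "(\<integral>x. (t \<bullet> x)\<^sup>2 * indicator (- ?B) x \<partial>M) \<le> E / 2"
    \<comment> \<open>The main estimate divides by \<open>E\<close>; for \<open>E = 0\<close>
      monotonicity is enough.\<close>
    proof (cases "E = 0")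
      case True
      have "(\<integral>x. (t \<bullet> x)\<^sup>2 * indicator (- ?B) x \<partial>M) \<le> E"
        unfolding E_def by (intro integral_mono iB mom) (auto simp: indicator_def)
      with True show ?thesis by simp
    next
      case False
      with \<open>E \<ge> 0\<close> have "E > 0" by simp
      have "(\<integral>x. (t \<bullet> x)\<^sup>2 * indicator (- ?B) x \<partial>M)
          \<le> (\<integral>x. (t \<bullet> x) ^ 4 / (12 * E) + 3 * E * indicator (- ?B) x \<partial>M)"
      proof (intro integral_mono iB)
        show "integrable M (\<lambda>x. (t \<bullet> x) ^ 4 / (12 * E) + 3 * E * indicator (- ?B) x)"
          using mom(2) by (intro Bochner_Integration.integrable_add integrable_mult_right
              integrable_divide) (auto simp: emeasure_eq_measure)
        fix x
        \<comment> \<open>Cauchy-Schwarz in pointwise form, by completing a square. The weights are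
          balanced: the fourth-moment bound makes the first term integrate to at most
          \<open>3 * E\<^sup>2 / (12 * E) = E / 4\<close>, and the tail bound \<open>1 / 12\<close>
          makes the second at most \<open>E / 4\<close>.\<close>
        have "0 \<le> ((t \<bullet> x)\<^sup>2 - 6 * E)\<^sup>2 / (12 * E)" using \<open>E > 0\<close> by simp
        also have "\<dots> = (t \<bullet> x) ^ 4 / (12 * E) + 3 * E - (t \<bullet> x)\<^sup>2"
          using \<open>E > 0\<close> by (simp add: field_simps power2_eq_square power4_eq_xxxx)
        finally show "(t \<bullet> x)\<^sup>2 * indicator (- ?B) x \<le> (t \<bullet> x) ^ 4 / (12 * E) + 3 * E * indicator (- ?B) x"
          using \<open>E > 0\<close> by (auto simp: indicator_def)
      qed simp
      also have "\<dots> = (\<integral>x. (t \<bullet> x) ^ 4 \<partial>M) / (12 * E) + 3 * E * measure M (- ?B)"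
        using mom(2) by (subst Bochner_Integration.integral_add) (auto simp: emeasure_eq_measure sp)
      also have "\<dots> \<le> 3 * E\<^sup>2 / (12 * E) + 3 * E * (1 / 12)"
        using mom(3) n \<open>E > 0\<close>
        by (intro add_mono divide_right_mono mult_left_mono) (simp_all add: E_def)
      also have "\<dots> = E / 2" using \<open>E > 0\<close> by (simp add: power2_eq_square)
      finally show ?thesis .
    qed
    finally show ?thesis by (simp add: E_def)
  qed
  with that show ?thesis by blast
qed

lemma gaussian_imp_finite_second_moment:
  fixes M :: "'a::{real_inner, second_countable_topology} measure"
  assumes "sets M = sets borel" "gaussian M"
  shows "finite_second_moment M"
proof -
  note assms(1)[measurable_cong]
  interpret prob_space M by (rule gaussian_imp_prob_space[OF assms])
  obtain R where R: "\<And>t. (\<integral>x. (t \<bullet> x)\<^sup>2 \<partial>M) \<le> 2 * (\<integral>x. (t \<bullet> x)\<^sup>2 * indicator (cball 0 R) x \<partial>M)"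
    using gaussian_second_moment_truncation[OF assms] by blast
  let ?B = "cball (0::'a) R"
  have [measurable]: "?B \<in> sets M" by (simp add: assms(1))
  obtain C :: "nat \<Rightarrow> 'a set" where C: "\<And>n. finite (C n)" "\<And>n. pairwise orthogonal (C n)"
    and lim: "\<And>x. (\<lambda>n. \<Sum>b\<in>C n. (b \<bullet> x)\<^sup>2 / (b \<bullet> b)) \<longlonglongrightarrow> (norm x)\<^sup>2"
    using orthogonal_approximation by blast
  \<comment> \<open>The squared norm of the projection of \<open>x\<close> onto
    \<open>span (C n)\<close>; dividing by \<open>b \<bullet> b\<close> replaces normalizing the
    basis.\<close>
  define q where "q n x = (\<Sum>b\<in>C n. (b \<bullet> x)\<^sup>2 / (b \<bullet> b))" for n x
  have q_nonneg: "q n x \<ge> 0" for n x by (auto simp: q_def intro: sum_nonneg)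
  have q_le: "q n x \<le> (norm x)\<^sup>2" for n x unfolding q_def by (rule bessel_inequality[OF C(1) C(2)])
  have [measurable]: "q n \<in> borel_measurable M" for n unfolding q_def by measurable
  have bound: "(\<integral>\<^sup>+x. q n x \<partial>M) \<le> ennreal (2 * R\<^sup>2)" for n
  proof -
    note int = gaussian_inner_moments(1)[OF assms]
    have intB: "integrable M (\<lambda>x. (b \<bullet> x)\<^sup>2 * indicator ?B x)" for b
      using integrable_mult_indicator[OF _ int, of ?B b] by (simp add: mult.commute)
    have iq: "integrable M (q n)" unfolding q_def using int by auto
    have "(\<integral>x. q n x \<partial>M) = (\<Sum>b\<in>C n. (\<integral>x. (b \<bullet> x)\<^sup>2 \<partial>M) / (b \<bullet> b))"
      unfolding q_def using int by simp
    also have "\<dots> \<le> (\<Sum>b\<in>C n. 2 * (\<integral>x. (b \<bullet> x)\<^sup>2 * indicator ?B x \<partial>M) / (b \<bullet> b))"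
      using R by (intro sum_mono divide_right_mono) auto
    also have "\<dots> = (\<integral>x. (\<Sum>b\<in>C n. 2 * ((b \<bullet> x)\<^sup>2 * indicator ?B x) / (b \<bullet> b)) \<partial>M)"
      using intB by simp
    also have "\<dots> = (\<integral>x. 2 * (q n x * indicator ?B x) \<partial>M)"
      by (simp add: q_def sum_distrib_left sum_distrib_right mult.assoc)
    \<comment> \<open>On the ball Bessel gives \<open>q n x \<le> R\<^sup>2\<close>, so the bound
      depends neither on \<open>n\<close> nor on the dimension of the span.\<close>
    also have "\<dots> \<le> (\<integral>x. 2 * R\<^sup>2 \<partial>M)"
    proof (intro integral_mono)
      show "integrable M (\<lambda>x. 2 * (q n x * indicator ?B x))"
        using integrable_mult_indicator[OF _ iq, of ?B] by (simp add: mult.commute)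
      fix x
      have "q n x \<le> R\<^sup>2" if "x \<in> ?B"
        using q_le[of n x] power_mono[of "norm x" R 2] that by simp
      then show "2 * (q n x * indicator ?B x) \<le> 2 * R\<^sup>2"
        by (auto simp: indicator_def)
    qed simp
    also have "\<dots> = 2 * R\<^sup>2" by (simp add: prob_space)
    finally show ?thesis
      using iq q_nonneg by (simp add: nn_integral_eq_integral ennreal_leI)
  qed
  \<comment> \<open>The pointwise limit is written as a liminf to fit Fatou's lemma.\<close>
  have "(\<integral>\<^sup>+x. ennreal ((norm x)\<^sup>2) \<partial>M) = (\<integral>\<^sup>+x. liminf (\<lambda>n. ennreal (q n x)) \<partial>M)"
    using lim by (intro nn_integral_cong)
      (auto simp: q_def intro!: lim_imp_Liminf[symmetric] tendsto_ennrealI)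
  also have "\<dots> \<le> liminf (\<lambda>n. \<integral>\<^sup>+x. q n x \<partial>M)"
    by (rule nn_integral_liminf) simp
  also have "\<dots> \<le> liminf (\<lambda>n. ennreal (2 * R\<^sup>2))"
    using bound by (intro Liminf_mono) simp
  also have "\<dots> < \<infinity>" by (simp add: Liminf_const)
  finally show ?thesis by (simp add: finite_second_moment_def)
qed

section \<open>The mean, one-dimensional projections and the equivalence\<close>

text \<open>Since \<open>norm x \<le> 1 + (norm x)\<^sup>2\<close> and \<open>M\<close> is finite,
  the first moment is finite too. This makes the mean a genuine Bochner integral rather than a
  default value.\<close>

lemma finite_second_moment_imp_integrable:
  fixes M :: "'a::{real_inner, complete_space, second_countable_topology} measure"
  assumes "finite_measure M" "sets M = sets borel" "finite_second_moment M"
  shows "integrable M (\<lambda>x. x)"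
proof (rule integrable_if_norm_finite[OF assms(1)])
  note assms(2)[measurable_cong]
  interpret finite_measure M by fact
  show "(\<lambda>x. x) \<in> borel_measurable M" by measurable
  have "norm x \<le> 1 + (norm x)\<^sup>2" for x :: 'a
  proof -
    have "0 \<le> (norm x - 1)\<^sup>2 + norm x" by simp
    then show ?thesis by (simp add: power2_diff)
  qed
  then have "(\<integral>\<^sup>+x. ennreal (norm x) \<partial>M) \<le> (\<integral>\<^sup>+x. 1 + ennreal ((norm x)\<^sup>2) \<partial>M)"
    by (intro nn_integral_mono) (simp flip: ennreal_1 ennreal_plus)
  also have "\<dots> = emeasure M (space M) + (\<integral>\<^sup>+x. ennreal ((norm x)\<^sup>2) \<partial>M)"
    by (subst nn_integral_add) simp_all
  also have "\<dots> < \<infinity>"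
    using assms(3) by (simp add: finite_second_moment_def emeasure_eq_measure)
  finally show "(\<integral>\<^sup>+x. ennreal (norm x) \<partial>M) < \<infinity>" .
qed

text \<open>The bridge to dimension one: \<open>char_fun M\<close> along the line through
  \<open>t\<close> is the characteristic function of one real law.\<close>

lemma char_distr_inner:
  fixes M :: "'a::{real_inner, second_countable_topology} measure"
  assumes "sets M = sets borel"
  shows "char (distr M borel (\<lambda>x. t \<bullet> x)) u = char_fun M (u *\<^sub>R t)"
proof -
  note assms[measurable_cong]
  show ?thesis by (simp add: char_def char_fun_def integral_distr)
qed

lemma cov_form_eq_var: "cov_form M t t = var M (\<lambda>x. t \<bullet> x)"
  by (simp add: cov_form_def covariance_def var_def power2_eq_square)

lemma var_scale: "var M (\<lambda>x. u * f x) = u\<^sup>2 * var M f"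
  by (simp add: var_def right_diff_distrib[symmetric] power_mult_distrib)

theorem theorem4p18:
  fixes M :: "'a::{real_inner, complete_space, second_countable_topology} measure"
  assumes "finite_measure M"
    and "sets M = sets borel"
  shows "gaussian M \<longleftrightarrow>
    finite_second_moment M \<and>
    (\<forall>t::'a. char_fun M t =
       exp (\<i> * complex_of_real (t \<bullet> (\<integral>x. x \<partial>M)) - complex_of_real (cov_form M t t / 2)))"
proof (intro iffI conjI allI)
  assume g: "gaussian M"
  show fin: "finite_second_moment M" by (rule gaussian_imp_finite_second_moment[OF assms(2) g])
  fix t :: 'a
  \<comment> \<open>Integrability of the identity allows the inner product to pass through the
    integral.\<close>
  have mean: "(\<integral>x. t \<bullet> x \<partial>M) = t \<bullet> (\<integral>x. x \<partial>M)"
    using finite_second_moment_imp_integrable[OF assms fin] by simp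
  have "char_fun M t = char (normal_law (\<integral>x. t \<bullet> x \<partial>M) (var M (\<lambda>x. t \<bullet> x))) 1"
    using char_distr_inner[OF assms(2), of t 1] g bounded_linear_inner_right[of t]
    by (simp add: gaussian_def)
  then show "char_fun M t =
      exp (\<i> * complex_of_real (t \<bullet> (\<integral>x. x \<partial>M)) - complex_of_real (cov_form M t t / 2))"
    by (simp add: char_normal_law var_nonneg mean cov_form_eq_var)
next
  note assms(2)[measurable_cong]
  assume "finite_second_moment M \<and> (\<forall>t::'a. char_fun M t =
       exp (\<i> * complex_of_real (t \<bullet> (\<integral>x. x \<partial>M)) - complex_of_real (cov_form M t t / 2)))"
  then have fin: "finite_second_moment M" and psi: "\<And>t. char_fun M t =
       exp (\<i> * complex_of_real (t \<bullet> (\<integral>x. x \<partial>M)) - complex_of_real (cov_form M t t / 2))"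
    by auto
  interpret finite_measure M by fact
  \<comment> \<open>Evaluating the formula at \<open>t = 0\<close> gives total mass 1, which Levy's
    theorem needs and a finite measure alone does not provide.\<close>
  have "complex_of_real (measure M (space M)) = char_fun M 0" by (simp add: char_fun_def scaleR_conv_of_real)
  also have "\<dots> = 1" by (simp add: psi cov_form_eq_var var_def)
  finally have "prob_space M" by (intro prob_spaceI) (simp add: emeasure_eq_measure)
  then interpret prob_space M .
  show "gaussian M"
    unfolding gaussian_def
  proof (intro allI impI)
    fix L :: "'a \<Rightarrow> real" assume "bounded_linear L"
    then obtain t where L: "L = (\<lambda>x. t \<bullet> x)" by (rule riesz_representation)
    have mean: "(\<integral>x. t \<bullet> x \<partial>M) = t \<bullet> (\<integral>x. x \<partial>M)"
      using finite_second_moment_imp_integrable[OF assms fin] by simp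
    show "distr M borel L = normal_law (\<integral>x. L x \<partial>M) (var M L)"
      unfolding L
    proof (rule Levy_uniqueness)
      \<comment> \<open>At \<open>u\<close> the left side is
        \<open>char_fun M (u *\<^sub>R t)\<close>. The formula applies to this scaled vector, and
        \<open>var_scale\<close> extracts the factor \<open>u\<^sup>2\<close> that
        \<open>char_normal_law\<close> has.\<close>
      show "char (distr M borel (\<lambda>x. t \<bullet> x)) = char (normal_law (\<integral>x. t \<bullet> x \<partial>M) (var M (\<lambda>x. t \<bullet> x)))"
        by (rule ext)
          (simp add: char_distr_inner assms(2) psi char_normal_law var_nonneg mean
            cov_form_eq_var var_scale)
    qed (simp_all add: real_distribution_normal_law var_nonneg)
  qed
qed

end
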